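(* Let $f\colon\mathbb{R}^n\to[-\infty,+\infty]$ be a proper nearly convex function and let $D\subset\mathbb{R}^n$ be a nonempty nearly convex set. Consider the nearly convex problem (P): $\min\{f(x)\mid x\in D\}$ and its associated convex problem ($\bar{\mathrm P}$): $\min\{\bar f(x)\mid x\in\bar D\}$, and let $\mathcal S_1$ be the solution set of ($\bar{\mathrm P}$). Let (R) denote the regularity condition $(\mathrm{ri}\,D)\cap\mathrm{ri}(\mathrm{dom}\,f)\neq\emptyset$. Then: (a) A point $\bar x\in\bar D$ with $\bar f(\bar x)\in\mathbb{R}$ is a solution of ($\bar{\mathrm P}$) if and only if $0\in\partial(\bar f+\delta_{\bar D})(\bar x)$. (b) If (R) is satisfied, then a point $\bar x\in\bar D$ is a solution of ($\bar{\mathrm P}$) if and only if $0\in\partial\bar f(\bar x)+N(\bar x;\bar D)$; hence $\mathcal S_1=\{\bar x\in\mathbb{R}^n\mid 0\in\partial\bar f(\bar x)+N(\bar x;\bar D)\}$. (c) If (R) holds and $\bar x\in D$ is a solution of (P), then $0\in\partial\bar f(\bar x)+N(\bar x;\bar D)$. (d) If (R) holds, then any point $\bar x\in D\cap\mathrm{ri}(\mathrm{dom}\,\bar f)$ satisfying $0\in\partial\bar f(\bar x)+N(\bar x;\bar D)$ is a solution of (P).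
   Context: A set $\Omega\subset\mathbb{R}^n$ is nearly convex if there is a convex set $C\subset\mathbb{R}^n$ with $C\subset\Omega\subset\bar C$, where the bar on a set denotes topological closure. For an arbitrary set $\Omega$, $\mathrm{ri}\,\Omega$ is the interior of $\Omega$ relative to its affine hull. For $f\colon\mathbb{R}^n\to[-\infty,+\infty]$: $\mathrm{dom}\,f=\{x\mid f(x)<+\infty\}$, $\mathrm{epi}\,f=\{(x,\lambda)\in\mathbb{R}^n\times\mathbb{R}\mid f(x)\le\lambda\}$; $f$ is proper if $\mathrm{dom}\,f\ne\emptyset$ and $f(x)>-\infty$ for all $x$; $f$ is nearly convex if $\mathrm{epi}\,f$ is a nearly convex set. The function $\bar f\colon\mathbb{R}^n\to[-\infty,+\infty]$ is defined by $\bar f(x)=\inf\{\alpha\in\mathbb{R}\mid (x,\alpha)\in\overline{\mathrm{epi}\,f}\}$, with $\inf\emptyset=+\infty$. $\delta_{E}(x)=0$ if $x\in E$ and $\delta_E(x)=+\infty$ otherwise. For a function $h\colon\mathbb{R}^n\to[-\infty,+\infty]$ and $\bar x$ with $h(\bar x)\in\mathbb{R}$, $\partial h(\bar x)=\{x^*\in\mathbb{R}^n\mid\langle x^*,x-\bar x\rangle\le h(x)-h(\bar x)\ \text{for all }x\in\mathbb{R}^n\}$; set $\partial h(\bar x)=\emptyset$ if $h(\bar x)\notin\mathbb{R}$. The normal cone to a nearly convex set $\Omega$ is $N(\bar x;\Omega)=\{x^*\in\mathbb{R}^n\mid\langle x^*,x-\bar x\rangle\le0\ \text{for all }x\in\Omega\}$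 if $\bar x\in\Omega$, and $N(\bar x;\Omega)=\emptyset$ if $\bar x\notin\Omega$. A solution of a problem $\min\{h(x)\mid x\in E\}$ is a point $\bar x\in E$ with $h(\bar x)\le h(x)$ for all $x\in E$. *)

theory Defs
  imports "HOL-Analysis.Analysis" "HOL-Library.Set_Algebras" "HOL-Library.Extended_Real"
begin

definition nearly_convex :: "'a::euclidean_space set \<Rightarrow> bool" where
  "nearly_convex \<Omega> \<longleftrightarrow> (\<exists>C. convex C \<and> C \<subseteq> \<Omega> \<and> \<Omega> \<subseteq> closure C)"

definition eff_dom :: "('a \<Rightarrow> ereal) \<Rightarrow> 'a set" where
  "eff_dom f = {x. f x < \<infinity>}"

definition epi :: "('a \<Rightarrow> ereal) \<Rightarrow> ('a \<times> real) set" where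
  "epi f = {(x, r). f x \<le> ereal r}"

definition proper_fun :: "('a \<Rightarrow> ereal) \<Rightarrow> bool" where
  "proper_fun f \<longleftrightarrow> eff_dom f \<noteq> {} \<and> (\<forall>x. f x > -\<infinity>)"

definition nearly_convex_fun :: "('a::euclidean_space \<Rightarrow> ereal) \<Rightarrow> bool" where
  "nearly_convex_fun f \<longleftrightarrow> nearly_convex (epi f)"

text \<open>The infimum is taken in the extended reals, so the infimum over the empty set is \<open>\<infinity>\<close>.\<close>

definition closure_fun :: "('a::euclidean_space \<Rightarrow> ereal) \<Rightarrow> 'a \<Rightarrow> ereal" where
  "closure_fun f x = Inf {ereal \<alpha> | \<alpha>. (x, \<alpha>) \<in> closure (epi f)}"

definition indicator_fun :: "'a set \<Rightarrow> 'a \<Rightarrow> ereal" where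
  "indicator_fun E x = (if x \<in> E then 0 else \<infinity>)"

text \<open>
  The condition \<open>\<bar>h xb\<bar> \<noteq> \<infinity>\<close> says that \<open>h xb\<close> is a real number; otherwise the
  subdifferential is empty.
\<close>

definition subdifferential :: "('a::euclidean_space \<Rightarrow> ereal) \<Rightarrow> 'a \<Rightarrow> 'a set" where
  "subdifferential h xb =
     (if \<bar>h xb\<bar> \<noteq> \<infinity> then {v. \<forall>x. ereal (v \<bullet> (x - xb)) \<le> h x - h xb} else {})"

definition normal_cone :: "'a::euclidean_space \<Rightarrow> 'a set \<Rightarrow> 'a set" where
  "normal_cone xb \<Omega> = (if xb \<in> \<Omega> then {v. \<forall>x\<in>\<Omega>. v \<bullet> (x - xb) \<le> 0} else {})"

definition solutions :: "('a \<Rightarrow> ereal) \<Rightarrow> 'a set \<Rightarrow> 'a set" where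
  "solutions h E = {xb \<in> E. \<forall>x\<in>E. h xb \<le> h x}"

end

theory Submission
  imports Defs
begin

text \<open>
  The closure of the epigraph of \<open>f\<close> has the same relative interior as a convex set squeezed
  inside \<open>epi f\<close>. Hence \<open>closure_fun f\<close> is a proper convex function that agrees with \<open>f\<close> on the
  relative interior of their domains, and those relative interiors coincide. If \<open>xb\<close> minimises a
  convex \<open>h\<close> over a convex set \<open>E\<close> with value \<open>m\<close>, the relative interiors of \<open>epi h\<close> and
  \<open>E \<times> {..m}\<close> are disjoint; the regularity condition makes a properly separating hyperplane
  non-vertical, and its slope is a subgradient of \<open>h\<close> whose negative is normal to \<open>E\<close>. Finally,
  a minimiser of \<open>f\<close> over \<open>D\<close> minimises the closed problem, since every feasible point is a limit
  along a segment lying in \<open>rel_interior D \<inter> rel_interior (eff_dom f)\<close>.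
\<close>

section \<open>Relative interiors and closures of nearly convex sets\<close>

text \<open>All sets between \<open>C\<close> and \<open>closure C\<close> have the same affine
  hull, so \<open>rel_interior\<close> is monotone along this chain, and for convex \<open>C\<close>
  its two ends agree.\<close>

lemma rel_interior_between_closure:
  fixes C :: "'a::euclidean_space set"
  assumes "convex C" "C \<subseteq> A" "A \<subseteq> closure C"
  shows "rel_interior A = rel_interior C"
proof -
  have "affine hull C = affine hull A"
    using hull_mono[OF assms(2), of affine] hull_mono[OF assms(3), of affine] by simp
  then have "rel_interior C \<subseteq> rel_interior A" "rel_interior A \<subseteq> rel_interior (closure C)"
    using subset_rel_interior[OF assms(2)] subset_rel_interior[OF assms(3)] by simp_all
  then show ?thesis
    unfolding convex_rel_interior_closure[OF assms(1)] by (rule subset_antisym[rotated])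
qed

lemma nearly_convexE:
  fixes A :: "'a::euclidean_space set"
  assumes "nearly_convex A"
  obtains C where "convex C" "C \<subseteq> A" "A \<subseteq> closure C" "closure A = closure C"
    "rel_interior A = rel_interior C"
proof -
  obtain C where C: "convex C" "C \<subseteq> A" "A \<subseteq> closure C"
    using assms unfolding nearly_convex_def by blast
  moreover have "closure A = closure C"
    using closure_mono[OF C(2)] closure_minimal[OF C(3)] by simp
  ultimately show thesis
    using that rel_interior_between_closure[OF C] by simp
qed

lemma nearly_convex_closure:
  fixes A :: "'a::euclidean_space set"
  assumes "nearly_convex A"
  shows "convex (closure A)" "rel_interior (closure A) = rel_interior A"
  using assms by (metis nearly_convexE convex_closure, metis nearly_convexE convex_rel_interior_closure)

section \<open>Effective domains and relative interiors of epigraphs\<close>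

lemma eff_dom_eq_fst_epi: "eff_dom h = fst ` epi h"
proof (intro set_eqI iffI)
  fix x assume "x \<in> eff_dom h"
  then obtain r where "h x \<le> ereal r"
    by (cases "h x") (auto simp: eff_dom_def)
  then show "x \<in> fst ` epi h"
    by (force simp: epi_def)
next
  fix x assume "x \<in> fst ` epi h"
  then show "x \<in> eff_dom h"
    by (auto simp: epi_def eff_dom_def less_top intro: le_less_trans)
qed

lemma convex_eff_dom: "convex (eff_dom h)" if "convex (epi h)" for h :: "'a::euclidean_space \<Rightarrow> ereal"
  unfolding eff_dom_eq_fst_epi using that by (intro convex_linear_image linear_fst)

text \<open>The relative interior of a convex set in a product is computed fibrewise over the
  relative interior of its projection; here each nonempty fibre is a closed upward ray or the whole
  line.\<close>

lemma rel_interior_epi: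
  fixes h :: "'a::euclidean_space \<Rightarrow> ereal"
  assumes "convex (epi h)"
  shows "(x, r) \<in> rel_interior (epi h) \<longleftrightarrow> x \<in> rel_interior (eff_dom h) \<and> h x < ereal r"
proof -
  have fib: "{z. h y \<le> ereal z} =
      (case h y of ereal c \<Rightarrow> {c..} | PInfty \<Rightarrow> {} | MInfty \<Rightarrow> UNIV)" for y
    by (cases "h y") auto
  have "(x, r) \<in> rel_interior (epi h) \<longleftrightarrow>
      x \<in> rel_interior {y. {z. h y \<le> ereal z} \<noteq> {}} \<and> r \<in> rel_interior {z. h x \<le> ereal z}"
    by (rule rel_interior_projection[OF assms]) (auto simp: epi_def)
  moreover have "{y. {z. h y \<le> ereal z} \<noteq> {}} = eff_dom h"
    by (force simp: eff_dom_eq_fst_epi epi_def)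
  moreover have "r \<in> rel_interior {z. h x \<le> ereal z} \<longleftrightarrow> h x < ereal r"
    unfolding fib by (cases "h x") auto
  ultimately show ?thesis by simp
qed

section \<open>The closure of a nearly convex function\<close>

lemma closure_epi_mono:
  fixes f :: "'a::euclidean_space \<Rightarrow> ereal"
  assumes "(x, r) \<in> closure (epi f)" "r \<le> s"
  shows "(x, s) \<in> closure (epi f)"
proof -
  have "(+) (0, s - r) ` epi f \<subseteq> epi f"
  proof (rule image_subsetI)
    fix p assume p: "p \<in> epi f"
    have "f (fst p) \<le> ereal (snd p)" using p by (auto simp: epi_def)
    also have "ereal (snd p) \<le> ereal (s - r + snd p)" using assms by simp
    finally show "(0, s - r) + p \<in> epi f" by (cases p) (simp add: epi_def)
  qed
  then have "(+) (0, s - r) ` closure (epi f) \<subseteq> closure (epi f)"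
    using closure_mono by (metis closure_translation)
  then have "(0, s - r) + (x, r) \<in> closure (epi f)"
    using assms by blast
  then show ?thesis by simp
qed

lemma epi_closure_fun:
  fixes f :: "'a::euclidean_space \<Rightarrow> ereal"
  shows "epi (closure_fun f) = closure (epi f)"
proof (intro set_eqI iffI; clarify)
  fix x r assume "(x, r) \<in> epi (closure_fun f)"
  then have le: "closure_fun f x \<le> ereal r" by (simp add: epi_def)
  \<comment> \<open>Attainment of the infimum is not known yet, so \<open>r\<close> is approached
    from above.\<close>
  have "(x, r + inverse (real (Suc n))) \<in> closure (epi f)" for n
  proof -
    have "closure_fun f x < ereal (r + inverse (real (Suc n)))"
      using le by (rule le_less_trans) simp
    then obtain a where "(x, a) \<in> closure (epi f)" "a < r + inverse (real (Suc n))"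
      unfolding closure_fun_def Inf_less_iff by auto
    then show ?thesis using closure_epi_mono less_imp_le by metis
  qed
  moreover have "(\<lambda>n. (x, r + inverse (real (Suc n)))) \<longlonglongrightarrow> (x, r + 0)"
    by (intro tendsto_intros LIMSEQ_inverse_real_of_nat)
  ultimately show "(x, r) \<in> closure (epi f)"
    using closed_sequentially[OF closed_closure] by fastforce
next
  fix x r assume "(x, r) \<in> closure (epi f)"
  then show "(x, r) \<in> epi (closure_fun f)"
    by (auto simp: epi_def closure_fun_def intro: Inf_lower)
qed

lemma closure_fun_le:
  fixes f :: "'a::euclidean_space \<Rightarrow> ereal"
  shows "closure_fun f x \<le> f x"
proof (rule ereal_le_real)
  fix r assume "f x \<le> ereal r"
  then have "(x, r) \<in> epi (closure_fun f)"
    unfolding epi_closure_fun by (intro closure_subset[THEN subsetD]) (simp add: epi_def)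
  then show "closure_fun f x \<le> ereal r" by (simp add: epi_def)
qed

lemma convex_epi_closure_fun:
  fixes f :: "'a::euclidean_space \<Rightarrow> ereal"
  assumes "nearly_convex_fun f"
  shows "convex (epi (closure_fun f))"
  using assms nearly_convex_closure unfolding epi_closure_fun nearly_convex_fun_def by blast

lemma rel_interior_eff_dom_closure_fun:
  fixes f :: "'a::euclidean_space \<Rightarrow> ereal"
  assumes "nearly_convex_fun f"
  shows "rel_interior (eff_dom (closure_fun f)) = rel_interior (eff_dom f)"
proof -
  obtain C where C: "convex C" "C \<subseteq> epi f" "closure (epi f) = closure C"
    using assms nearly_convexE unfolding nearly_convex_fun_def by metis
  have cv: "convex (fst ` C)"
    using C by (intro convex_linear_image linear_fst)
  have up: "fst ` closure C \<subseteq> closure (fst ` C)"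
    by (intro closure_linear_image_subset linear_fst)
  have sub: "epi f \<subseteq> closure C"
    using C closure_subset by metis
  have "rel_interior (fst ` closure C) = rel_interior (fst ` C)"
    using cv up image_mono[OF closure_subset[of C]] by (intro rel_interior_between_closure)
  moreover have "rel_interior (fst ` epi f) = rel_interior (fst ` C)"
    using cv up sub C by (intro rel_interior_between_closure) blast+
  ultimately show ?thesis
    by (simp add: eff_dom_eq_fst_epi epi_closure_fun C)
qed

text \<open>A point strictly above the graph of \<open>closure_fun f\<close> over this set is in the
  relative interior of \<open>closure (epi f)\<close>, which near convexity identifies with that of
  \<open>epi f\<close>.\<close>

lemma closure_fun_eq_on_rel_interior:
  fixes f :: "'a::euclidean_space \<Rightarrow> ereal"
  assumes "nearly_convex_fun f" "x \<in> rel_interior (eff_dom f)"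
  shows "closure_fun f x = f x"
proof (rule antisym[OF closure_fun_le])
  show "f x \<le> closure_fun f x"
  proof (rule dense_ge)
    fix s assume "closure_fun f x < s"
    then obtain r where r: "closure_fun f x < ereal r" "ereal r < s"
      using ereal_dense2 by blast
    then have "(x, r) \<in> rel_interior (epi (closure_fun f))"
      using assms by (simp add: rel_interior_epi convex_epi_closure_fun rel_interior_eff_dom_closure_fun)
    then have "(x, r) \<in> rel_interior (epi f)"
      using assms by (simp add: epi_closure_fun nearly_convex_closure nearly_convex_fun_def)
    then have "f x \<le> ereal r"
      using rel_interior_subset by (fastforce simp: epi_def)
    then show "f x \<le> s" using r by order
  qed
qed

lemma convex_epi_segment:
  assumes "convex (epi h)" "h x \<le> ereal r" "h y \<le> ereal s" "0 \<le> t" "t \<le> 1"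
  shows "h ((1 - t) *\<^sub>R x + t *\<^sub>R y) \<le> ereal ((1 - t) * r + t * s)"
proof -
  have "(1 - t) *\<^sub>R (x, r) + t *\<^sub>R (y, s) \<in> epi h"
    using assms by (intro convexD) (auto simp: epi_def)
  then show ?thesis by (simp add: epi_def)
qed

text \<open>A convex function with value -\<infinity> somewhere is -\<infinity> on the relative
  interior of its domain, but there \<open>closure_fun f\<close> agrees with the proper
  \<open>f\<close>.\<close>

lemma closure_fun_gt_MInfty:
  fixes f :: "'a::euclidean_space \<Rightarrow> ereal"
  assumes "proper_fun f" "nearly_convex_fun f"
  shows "closure_fun f x > -\<infinity>"
proof (rule ccontr)
  assume "\<not> closure_fun f x > -\<infinity>"
  then have x: "closure_fun f x = -\<infinity>" by simp
  define h where "h = closure_fun f"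
  have cv: "convex (epi h)"
    unfolding h_def by (rule convex_epi_closure_fun[OF assms(2)])
  have xd: "x \<in> eff_dom h" using x by (simp add: eff_dom_def h_def)
  then obtain z where z: "z \<in> rel_interior (eff_dom h)"
    using rel_interior_eq_empty[OF convex_eff_dom[OF cv]] by blast
  \<comment> \<open>The segment from \<open>x\<close> to \<open>z\<close> can be prolonged beyond
    \<open>z\<close> inside the domain, which puts \<open>z\<close> strictly between
    \<open>x\<close> and \<open>w\<close>.\<close>
  then obtain e where e: "e > 1" "(1 - e) *\<^sub>R x + e *\<^sub>R z \<in> eff_dom h"
    using convex_rel_interior_iff[OF convex_eff_dom[OF cv]] xd by blast
  define w where "w = (1 - e) *\<^sub>R x + e *\<^sub>R z"
  obtain b where b: "h w \<le> ereal b"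
    using e by (auto simp: eff_dom_eq_fst_epi epi_def w_def)
  define t where "t = 1 / e"
  have t: "0 < t" "t < 1" using e by (auto simp: t_def)
  have "(1 - t) *\<^sub>R x + t *\<^sub>R w = ((1 - t) + t * (1 - e)) *\<^sub>R x + (t * e) *\<^sub>R z"
    by (simp add: w_def scaleR_add_right scaleR_add_left)
  moreover have "t * e = 1" using e by (simp add: t_def)
  ultimately have zw: "z = (1 - t) *\<^sub>R x + t *\<^sub>R w"
    by (simp add: right_diff_distrib)
  have "h z \<le> ereal B" for B
  proof -
    \<comment> \<open>Any height is admissible over \<open>x\<close>; this one makes the combination
      with \<open>b\<close> equal to \<open>B\<close>.\<close>
    have "h z \<le> ereal ((1 - t) * ((B - t * b) / (1 - t)) + t * b)"
      unfolding zw using t b x cv by (intro convex_epi_segment) (auto simp: h_def)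
    then show ?thesis using t by simp
  qed
  then have "h z = -\<infinity>" by (rule ereal_bot)
  moreover have "h z = f z"
    using z assms unfolding h_def
    by (simp add: closure_fun_eq_on_rel_interior rel_interior_eff_dom_closure_fun)
  ultimately show False
    using assms(1) unfolding proper_fun_def by (metis less_irrefl)
qed

section \<open>Optimality conditions for minimising a function over a set\<close>

lemma zero_in_subdifferential_iff:
  assumes "\<bar>h xb\<bar> \<noteq> \<infinity>"
  shows "0 \<in> subdifferential h xb \<longleftrightarrow> (\<forall>x. h xb \<le> h x)"
  using assms by (cases "h xb") (auto simp: subdifferential_def ereal_le_minus_iff zero_ereal_def[symmetric])

text \<open>Off \<open>E\<close> the sum is \<infinity> even where \<open>h\<close> is -\<infinity>,
  by the convention for \<open>ereal\<close> addition, so its global minimality at \<open>xb\<close>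
  is minimality of \<open>h\<close> over \<open>E\<close>.\<close>

lemma solutions_iff_zero_in_subdifferential_add_indicator:
  assumes "xb \<in> E" "\<bar>h xb\<bar> \<noteq> \<infinity>"
  shows "xb \<in> solutions h E \<longleftrightarrow> 0 \<in> subdifferential (\<lambda>x. h x + indicator_fun E x) xb"
  using assms by (subst zero_in_subdifferential_iff) (auto simp: solutions_def indicator_fun_def)

lemma solutions_if_zero_in_subdifferential_plus_normal_cone:
  assumes "0 \<in> subdifferential h xb + normal_cone xb E"
  shows "xb \<in> solutions h E"
proof -
  obtain u v where uv: "0 = u + v" "u \<in> subdifferential h xb" "v \<in> normal_cone xb E"
    using assms by (auto elim: set_plus_elim)
  \<comment> \<open>Both sets are empty by convention in the degenerate cases, so having elements
    yields feasibility and finiteness.\<close>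
  then have xb: "xb \<in> E" and v: "\<And>x. x \<in> E \<Longrightarrow> v \<bullet> (x - xb) \<le> 0"
    by (auto simp: normal_cone_def split: if_splits)
  have fin: "\<bar>h xb\<bar> \<noteq> \<infinity>" and u: "\<And>x. ereal (u \<bullet> (x - xb)) \<le> h x - h xb"
    using uv by (auto simp: subdifferential_def split: if_splits)
  have "h xb \<le> h x" if "x \<in> E" for x
  proof -
    have "u = - v" using uv by (simp add: eq_neg_iff_add_eq_0)
    then have "0 \<le> ereal (u \<bullet> (x - xb))" using v[OF that] by simp
    also have "\<dots> \<le> h x - h xb" by (rule u)
    finally show ?thesis using fin by (cases "h xb"; cases "h x") auto
  qed
  then show ?thesis using xb by (simp add: solutions_def)
qed

lemma zero_in_subdifferential_plus_normal_cone_if_solutions: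
  fixes h :: "'a::euclidean_space \<Rightarrow> ereal"
  assumes cv: "convex (epi h)" and fin: "\<bar>h xb\<bar> \<noteq> \<infinity>" and "convex E"
    and z: "z \<in> rel_interior E" "z \<in> rel_interior (eff_dom h)"
    and sol: "xb \<in> solutions h E"
  shows "0 \<in> subdifferential h xb + normal_cone xb E"
proof -
  obtain m where m: "h xb = ereal m" using fin by (cases "h xb") auto
  have xb: "xb \<in> E" and min: "\<And>x. x \<in> E \<Longrightarrow> ereal m \<le> h x"
    using sol m by (auto simp: solutions_def)
  \<comment> \<open>\<open>T\<close> is the reflection of \<open>E\<close> \<times>
    \<open>{..m}\<close>, so separating that set from \<open>epi h\<close> becomes supporting
    \<open>epi h + T\<close> at 0.\<close>
  define T where "T = (uminus ` E) \<times> {-m..}"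
  have cvE: "convex (uminus ` E)"
    using \<open>convex E\<close> by (rule convex_negations)
  have cvT: "convex T"
    unfolding T_def using cvE by (intro convex_Times) auto
  have "rel_interior (uminus ` E) = uminus ` rel_interior E"
    by (rule rel_interior_injective_linear_image) (auto simp: bounded_linear_minus[OF bounded_linear_ident] inj_def)
  then have riT: "rel_interior T = (uminus ` rel_interior E) \<times> {-m<..}"
    unfolding T_def using cvE by (simp add: rel_interior_Times)
  have ri: "rel_interior (epi h + T) = rel_interior (epi h) + rel_interior T"
    by (rule rel_interior_sum[OF cv cvT])
  have memT: "(- y, - s) \<in> T" if "y \<in> E" "s \<le> m" for y s
    using that by (auto simp: T_def)
  have "(xb, m) + (- xb, - m) \<in> epi h + T"
    using m xb by (intro set_plus_intro memT) (auto simp: epi_def)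
  then have "0 \<in> epi h + T" by (simp add: zero_prod_def)
  \<comment> \<open>Otherwise some point of \<open>E\<close> would have a value of \<open>h\<close>
    below the minimum \<open>m\<close>.\<close>
  moreover have "0 \<notin> rel_interior (epi h + T)"
  proof
    assume "0 \<in> rel_interior (epi h + T)"
    then obtain p q where pq: "0 = p + q" "p \<in> rel_interior (epi h)" "q \<in> rel_interior T"
      unfolding ri by (auto elim: set_plus_elim)
    obtain x r where p: "p = (x, r)" by (cases p)
    obtain y s where q: "q = (- y, s)" "y \<in> rel_interior E" "- m < s"
      using pq riT by auto
    have "x = y" "r < m" using pq(1) p q by (auto simp: zero_prod_def)
    moreover have "h x < ereal r"
      using pq(2) p rel_interior_epi[OF cv] by simp
    moreover have "ereal m \<le> h y"
      using min q(2) rel_interior_subset by blast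
    ultimately show False by (cases "h y") auto
  qed
  moreover have "convex (epi h + T)"
    using cv cvT by (rule convex_set_plus)
  ultimately obtain a where
      ge: "\<And>p. p \<in> epi h + T \<Longrightarrow> a \<bullet> 0 \<le> a \<bullet> p"
      and gt: "\<And>p. p \<in> rel_interior (epi h + T) \<Longrightarrow> a \<bullet> 0 < a \<bullet> p"
    using supporting_hyperplane_rel_boundary by metis
  obtain v b where a: "a = (v, b)" by (cases a)
  have sep: "0 \<le> v \<bullet> (x - y) + b * (r - s)" if "h x \<le> ereal r" "y \<in> E" "s \<le> m" for x y r s
    using ge[OF set_plus_intro[OF _ memT[OF that(2,3)]], of "(x, r)"] that
    by (simp add: a epi_def)
  \<comment> \<open>Raising the height by 1 above \<open>(xb, m)\<close> isolates
    \<open>b\<close>.\<close>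
  have "0 \<le> b"
    using sep[of xb "m + 1" xb m] m xb by simp
  moreover have "b \<noteq> 0"
  proof
    \<comment> \<open>A vertical hyperplane sees only the first coordinate, which vanishes for the
      sum built over \<open>z\<close>; yet that sum is in the relative interior, where
      \<open>a\<close> is strictly positive.\<close>
    assume "b = 0"
    have "h z < \<infinity>" using z(2) rel_interior_subset by (fastforce simp: eff_dom_def)
    then obtain r where "h z < ereal r" using less_PInf_Ex_of_nat by force
    then have "(z, r) \<in> rel_interior (epi h)"
      using z rel_interior_epi[OF cv] by simp
    moreover have "(- z, 1 - m) \<in> rel_interior T"
      using z by (auto simp: riT)
    ultimately have "(z, r) + (- z, 1 - m) \<in> rel_interior (epi h + T)"
      unfolding ri by (rule set_plus_intro)
    from gt[OF this] show False by (simp add: a \<open>b = 0\<close>)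
  qed
  ultimately have b: "0 < b" by simp
  have "- (v /\<^sub>R b) \<in> subdifferential h xb"
  proof -
    have "ereal (- (v /\<^sub>R b) \<bullet> (x - xb)) \<le> h x - h xb" for x
    proof -
      \<comment> \<open>Testing against every real \<open>r\<close> above \<open>h x\<close> also
        covers infinite values of \<open>h x\<close>.\<close>
      have "ereal (m - (v /\<^sub>R b) \<bullet> (x - xb)) \<le> h x"
      proof (rule ereal_le_real)
        fix r assume "h x \<le> ereal r"
        from sep[OF this xb order_refl]
        show "ereal (m - (v /\<^sub>R b) \<bullet> (x - xb)) \<le> ereal r"
          using b by (simp add: field_simps)
      qed
      then show ?thesis by (cases "h x") (auto simp: m)
    qed
    then show ?thesis using fin by (simp add: subdifferential_def)
  qed
  moreover have "v /\<^sub>R b \<in> normal_cone xb E"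
  proof -
    \<comment> \<open>Here the epigraph point stays at \<open>(xb, m)\<close> and only the point of
      \<open>E\<close> varies.\<close>
    have "(v /\<^sub>R b) \<bullet> (x - xb) \<le> 0" if "x \<in> E" for x
      using sep[of xb m x m] m that b by (simp add: inner_diff_right field_simps)
    then show ?thesis using xb by (simp add: normal_cone_def)
  qed
  ultimately have "- (v /\<^sub>R b) + v /\<^sub>R b \<in> subdifferential h xb + normal_cone xb E"
    by (rule set_plus_intro)
  then show ?thesis by simp
qed

section \<open>From the original problem to the closed problem\<close>

lemma solutions_closure_fun_if_solutions:
  fixes f :: "'a::euclidean_space \<Rightarrow> ereal"
  assumes nc: "nearly_convex_fun f" and D: "nearly_convex D"
    and z: "z \<in> rel_interior D" "z \<in> rel_interior (eff_dom f)"
    and sol: "xb \<in> solutions f D"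
  shows "xb \<in> solutions (closure_fun f) (closure D)"
proof -
  define h where "h = closure_fun f"
  have cv: "convex (epi h)"
    unfolding h_def by (rule convex_epi_closure_fun[OF nc])
  have ridom: "rel_interior (eff_dom h) = rel_interior (eff_dom f)"
    unfolding h_def by (rule rel_interior_eff_dom_closure_fun[OF nc])
  have xb: "xb \<in> D" and min: "\<And>x. x \<in> D \<Longrightarrow> f xb \<le> f x"
    using sol by (auto simp: solutions_def)
  have "z \<in> eff_dom h"
    using z ridom rel_interior_subset by blast
  then obtain s where s: "h z \<le> ereal s"
    by (auto simp: eff_dom_eq_fst_epi epi_def)
  have "f xb \<le> h x" if x: "x \<in> closure D" for x
  proof (rule ereal_le_real)
    fix r assume r: "h x \<le> ereal r"
    have le: "f xb \<le> ereal ((1 - t) * r + t * s)" if t: "0 < t" "t \<le> 1" for t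
    proof -
      \<comment> \<open>Moving from \<open>x\<close> towards \<open>z\<close> enters both relative
        interiors at once, so \<open>?y\<close> is feasible and \<open>f\<close> agrees with
        \<open>h\<close> there.\<close>
      let ?y = "x - t *\<^sub>R (x - z)"
      have y: "?y = (1 - t) *\<^sub>R x + t *\<^sub>R z" by (simp add: algebra_simps)
      have "?y \<in> rel_interior (closure D)"
        using nearly_convex_closure[OF D] x z t closure_closure
        by (intro rel_interior_closure_convex_shrink) auto
      then have "?y \<in> D"
        using nearly_convex_closure[OF D] rel_interior_subset by blast
      moreover have "?y \<in> rel_interior (eff_dom h)"
      proof (rule rel_interior_closure_convex_shrink)
        show "x \<in> closure (eff_dom h)"
          using r by (intro closure_subset[THEN subsetD]) (force simp: eff_dom_eq_fst_epi epi_def)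
      qed (use convex_eff_dom[OF cv] z ridom t in auto)
      then have "f ?y = h ?y"
        using closure_fun_eq_on_rel_interior[OF nc] by (simp add: h_def ridom[unfolded h_def])
      ultimately have "f xb \<le> h ?y" using min by metis
      also have "\<dots> \<le> ereal ((1 - t) * r + t * s)"
        unfolding y using cv r s t by (intro convex_epi_segment) auto
      finally show ?thesis .
    qed
    \<comment> \<open>Sliding back to \<open>x\<close> removes the contribution of \<open>z\<close>
      from the bound.\<close>
    have lim: "((\<lambda>t. ereal ((1 - t) * r + t * s)) \<longlongrightarrow> ereal ((1 - 0) * r + 0 * s)) (at_right 0)"
      by (intro tendsto_intros)
    have "eventually (\<lambda>t. f xb \<le> ereal ((1 - t) * r + t * s)) (at_right 0)"
      by (rule eventually_mono[OF eventually_at_right_real[of 0 1]]) (auto intro: le)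
    from tendsto_lowerbound[OF lim this] show "f xb \<le> ereal r" by simp
  qed
  then have "h xb \<le> h x" if "x \<in> closure D" for x
    using that closure_fun_le[of f xb] unfolding h_def by (meson order_trans)
  then show ?thesis
    using xb closure_subset by (auto simp: solutions_def h_def)
qed

section \<open>Optimality conditions for the nearly convex problem\<close>

theorem theorem4p2:
  fixes f :: "'a::euclidean_space \<Rightarrow> ereal" and D :: "'a set"
  assumes "proper_fun f"
    and "nearly_convex_fun f"
    and "D \<noteq> {}"
    and "nearly_convex D"
  shows
    "(\<forall>xb \<in> closure D. \<bar>closure_fun f xb\<bar> \<noteq> \<infinity> \<longrightarrow>
        (xb \<in> solutions (closure_fun f) (closure D) \<longleftrightarrow>
          0 \<in> subdifferential (\<lambda>x. closure_fun f x + indicator_fun (closure D) x) xb)) \<and>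
     (rel_interior D \<inter> rel_interior (eff_dom f) \<noteq> {} \<longrightarrow>
        (\<forall>xb \<in> closure D. xb \<in> solutions (closure_fun f) (closure D) \<longleftrightarrow>
            0 \<in> subdifferential (closure_fun f) xb + normal_cone xb (closure D)) \<and>
        solutions (closure_fun f) (closure D) =
          {xb. 0 \<in> subdifferential (closure_fun f) xb + normal_cone xb (closure D)}) \<and>
     (rel_interior D \<inter> rel_interior (eff_dom f) \<noteq> {} \<longrightarrow>
        (\<forall>xb \<in> D. xb \<in> solutions f D \<longrightarrow>
            0 \<in> subdifferential (closure_fun f) xb + normal_cone xb (closure D))) \<and>
     (rel_interior D \<inter> rel_interior (eff_dom f) \<noteq> {} \<longrightarrow>
        (\<forall>xb \<in> D \<inter> rel_interior (eff_dom (closure_fun f)).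
            0 \<in> subdifferential (closure_fun f) xb + normal_cone xb (closure D) \<longrightarrow>
            xb \<in> solutions f D))"
proof -
  let ?h = "closure_fun f" and ?R = "rel_interior D \<inter> rel_interior (eff_dom f) \<noteq> {}"
  note nc = assms(2) and D = assms(4)
  have b_imp: "0 \<in> subdifferential ?h xb + normal_cone xb (closure D)"
    if R: ?R and sol: "xb \<in> solutions ?h (closure D)" for xb
  proof -
    obtain z where z: "z \<in> rel_interior (closure D)" "z \<in> rel_interior (eff_dom ?h)"
      using R nearly_convex_closure[OF D] rel_interior_eff_dom_closure_fun[OF nc] by auto
    then have "z \<in> closure D" "z \<in> eff_dom ?h"
      using rel_interior_subset by blast+
    \<comment> \<open>The common point \<open>z\<close> bounds the minimal value from above, and
      properness bounds it from below, so the value is real.\<close>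
    then have "?h xb \<le> ?h z" "?h z < \<infinity>"
      using sol by (simp_all add: solutions_def eff_dom_def)
    then have "?h xb < \<infinity>"
      by (rule le_less_trans)
    then have "\<bar>?h xb\<bar> \<noteq> \<infinity>"
      using closure_fun_gt_MInfty[OF assms(1) nc, of xb] by (cases "?h xb") auto
    from convex_epi_closure_fun[OF nc] this nearly_convex_closure(1)[OF D] z sol show ?thesis
      by (rule zero_in_subdifferential_plus_normal_cone_if_solutions)
  qed
  have b: "xb \<in> solutions ?h (closure D) \<longleftrightarrow>
      0 \<in> subdifferential ?h xb + normal_cone xb (closure D)" if ?R for xb
    using b_imp[OF that] solutions_if_zero_in_subdifferential_plus_normal_cone by blast
  have c: "0 \<in> subdifferential ?h xb + normal_cone xb (closure D)"
    if ?R "xb \<in> solutions f D" for xb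
    using that b solutions_closure_fun_if_solutions[OF nc D] by blast
  have d: "xb \<in> solutions f D"
    if R: ?R and xb: "xb \<in> D" "xb \<in> rel_interior (eff_dom ?h)"
      and zero: "0 \<in> subdifferential ?h xb + normal_cone xb (closure D)" for xb
  proof -
    \<comment> \<open>The minimum of the closed problem is thus a value of \<open>f\<close> itself,
      while \<open>f\<close> lies above \<open>?h\<close> everywhere.\<close>
    have "f xb = ?h xb"
      using xb by (simp add: closure_fun_eq_on_rel_interior rel_interior_eff_dom_closure_fun nc)
    moreover have "?h xb \<le> f x" if "x \<in> D" for x
    proof -
      have "?h xb \<le> ?h x"
        using zero b[OF R] that closure_subset unfolding solutions_def by blast
      then show ?thesis using closure_fun_le by (rule order_trans)
    qed
    ultimately show ?thesis
      using xb by (simp add: solutions_def)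
  qed
  show ?thesis
  proof (intro conjI impI ballI)
    assume R: ?R
    show "solutions ?h (closure D) = {xb. 0 \<in> subdifferential ?h xb + normal_cone xb (closure D)}"
      using b[OF R] by blast
  qed (use solutions_iff_zero_in_subdifferential_add_indicator b c d in \<open>simp_all\<close>)
qed

end
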